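(* Let $G=(\mathcal N,\mathcal E)$, $\mathcal N=\{1,\dots,n\}$, be a time-invariant directed graph with $\mathcal V_{\mathrm t}\cap\mathcal V_{\mathrm h}=\emptyset$. Let $V_{\mathrm{ud}},\bar V_{\mathrm{ud}}:\mathbb R^{d\times n}\to\mathbb R$ be continuously differentiable and nonnegative, with $V_{\mathrm{ud}}$ gradient-distributed with respect to $G_{\mathrm{ud}}$ and $\bar V_{\mathrm{ud}}$ gradient-distributed with respect to $\bar G_{\mathrm{ud}}$. Let $\lambda_i,\eta_i>0$, $\kappa_i\ge 0$ for $i\in\mathcal V_{\mathrm t}$ and $\mu_i>0$ for $i\in\mathcal N\setminus\mathcal V_{\mathrm t}$. Then the controller $$f_i(X)=\begin{cases}-\bar g_i(X)-\kappa_i\nabla_iV_{\mathrm{ud}}(X), & i\in\mathcal V_{\mathrm t},\\ -\mu_i\nabla_iV_{\mathrm{ud}}(X), & i\in\mathcal N\setminus\mathcal V_{\mathrm t},\end{cases}$$ is a distributed controller with respect to $G$, i.e. for every $i\in\mathcal N$ the value $f_i(X)$ depends only on $x_i$ and on $x_j$, $j\in\mathcal N_i(G)$.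
   Context: Graphs: $\mathcal E\subset\mathcal N\times\mathcal N$. An edge $(i,j)\in\mathcal E$ has tail $i$ and head $j$; it is bidirectional if also $(j,i)\in\mathcal E$, and unidirectional otherwise. $\mathcal E_{\mathrm{ud}}$ and $\mathcal E_{\mathrm{di}}$ are the sets of bidirectional and unidirectional edges of $G$. $G_{\mathrm{ud}}=(\mathcal N,\mathcal E_{\mathrm{ud}})$ and $\bar G_{\mathrm{ud}}=(\mathcal N,\bar{\mathcal E}_{\mathrm{ud}})$ with $\bar{\mathcal E}_{\mathrm{ud}}=\mathcal E\cup\{(i,j):(j,i)\in\mathcal E_{\mathrm{di}}\}$. $\mathcal V_{\mathrm t}=\{i:\exists j,\ (i,j)\in\mathcal E_{\mathrm{di}}\}$ and $\mathcal V_{\mathrm h}=\{i:\exists j,\ (j,i)\in\mathcal E_{\mathrm{di}}\}$. For a graph $H=(\mathcal N,\mathcal E_H)$, $\mathcal N_i(H)=\{j\in\mathcal N:(i,j)\in\mathcal E_H\}$. Write $X=[x_1,\dots,x_n]\in\mathbb R^{d\times n}$ with columns $x_i\in\mathbb R^d$ and $\nabla_iV=\partial V/\partial x_i$. A differentiable function $V$ is gradient-distributed with respect to a graph $H$ on $\mathcal N$ if for each $i\in\mathcal N$, $\nabla_iV(X)$ is a function of $x_i$ and $[x_j]_{j\in\mathcal N_i(H)}$ only. For $i\in\mathcal V_{\mathrm t}$, $\bar g_i(X)\in\mathbb R^d$ is the (unique) minimizer of $\left\|g-\tfrac12\left(\lambda_i\nabla_i\bar V_{\mathrm{ud}}(X)+\eta_i\nabla_iV_{\mathrm{ud}}(X)\right)\right\|^2$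 over $g\in\mathbb R^d$ subject to $g^\top\nabla_i\bar V_{\mathrm{ud}}(X)\ge 0$ and $g^\top\nabla_iV_{\mathrm{ud}}(X)\ge 0$. *)

theory Defs
  imports "HOL-Analysis.Analysis"
begin

text \<open>
  The node set is the finite type \<open>'n\<close>, a directed graph on it is its edge relation, and
  the matrix \<open>X = [x_1, ..., x_n]\<close> with columns in \<open>\<real>\<^sup>d\<close> is an element of
  \<open>(real ^ 'd) ^ 'n\<close>, so that \<open>X $ i\<close> is the column \<open>x_i\<close>.
\<close>

type_synonym ('d, 'n) config = "(real ^ 'd) ^ 'n"

definition bidir_edges :: "('n \<times> 'n) set \<Rightarrow> ('n \<times> 'n) set" where
  "bidir_edges E = {(i, j). (i, j) \<in> E \<and> (j, i) \<in> E}"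

definition unidir_edges :: "('n \<times> 'n) set \<Rightarrow> ('n \<times> 'n) set" where
  "unidir_edges E = {(i, j). (i, j) \<in> E \<and> (j, i) \<notin> E}"

definition closure_edges :: "('n \<times> 'n) set \<Rightarrow> ('n \<times> 'n) set" where
  "closure_edges E = E \<union> {(i, j). (j, i) \<in> unidir_edges E}"

definition tails :: "('n \<times> 'n) set \<Rightarrow> 'n set" where
  "tails E = {i. \<exists>j. (i, j) \<in> unidir_edges E}"

definition heads :: "('n \<times> 'n) set \<Rightarrow> 'n set" where
  "heads E = {i. \<exists>j. (j, i) \<in> unidir_edges E}"

definition neighbors :: "('n \<times> 'n) set \<Rightarrow> 'n \<Rightarrow> 'n set" where
  "neighbors H i = {j. (i, j) \<in> H}"

definition set_column :: "('d::finite, 'n::finite) config \<Rightarrow> 'n \<Rightarrow> real ^ 'd \<Rightarrow> ('d, 'n) config" where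
  "set_column X i y = (\<chi> j. if j = i then y else X $ j)"

text \<open>The partial gradient of \<open>V\<close> with respect to the column \<open>x_i\<close>.\<close>

definition pgrad :: "(('d::finite, 'n::finite) config \<Rightarrow> real) \<Rightarrow> 'n \<Rightarrow> ('d, 'n) config \<Rightarrow> real ^ 'd" where
  "pgrad V i X = (THE D. GDERIV (\<lambda>y. V (set_column X i y)) (X $ i) :> D)"

definition continuously_differentiable :: "('a::real_normed_vector \<Rightarrow> 'b::real_normed_vector) \<Rightarrow> bool" where
  "continuously_differentiable V \<longleftrightarrow>
     (\<exists>V' :: 'a \<Rightarrow> 'a \<Rightarrow>\<^sub>L 'b.
        (\<forall>X. (V has_derivative blinfun_apply (V' X)) (at X)) \<and> continuous_on UNIV V')"

definition depends_only_on :: "(('d::finite, 'n::finite) config \<Rightarrow> 'b) \<Rightarrow> 'n set \<Rightarrow> bool" where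
  "depends_only_on F S \<longleftrightarrow> (\<forall>X Y. (\<forall>j\<in>S. X $ j = Y $ j) \<longrightarrow> F X = F Y)"

definition gradient_distributed ::
    "('n \<times> 'n) set \<Rightarrow> (('d::finite, 'n::finite) config \<Rightarrow> real) \<Rightarrow> bool" where
  "gradient_distributed H V \<longleftrightarrow>
     (\<forall>X. V differentiable (at X)) \<and>
     (\<forall>i. depends_only_on (pgrad V i) (insert i (neighbors H i)))"

definition distributed_controller ::
    "('n \<times> 'n) set \<Rightarrow> ('n \<Rightarrow> ('d::finite, 'n::finite) config \<Rightarrow> real ^ 'd) \<Rightarrow> bool" where
  "distributed_controller G f \<longleftrightarrow> (\<forall>i. depends_only_on (f i) (insert i (neighbors G i)))"

text \<open>
  In \<open>gbar\<close> and \<open>controller\<close>, \<open>Vb\<close> is the function associated with \<open>closure_edges E\<close>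
  and \<open>V\<close> the one associated with \<open>bidir_edges E\<close>.
\<close>

definition gbar ::
    "(('d::finite, 'n::finite) config \<Rightarrow> real) \<Rightarrow> (('d, 'n) config \<Rightarrow> real) \<Rightarrow>
     ('n \<Rightarrow> real) \<Rightarrow> ('n \<Rightarrow> real) \<Rightarrow> 'n \<Rightarrow> ('d, 'n) config \<Rightarrow> real ^ 'd" where
  "gbar Vb V l \<eta> i X =
     (THE g. is_arg_min
        (\<lambda>g. (norm (g - (1/2) *\<^sub>R (l i *\<^sub>R pgrad Vb i X + \<eta> i *\<^sub>R pgrad V i X)))\<^sup>2)
        (\<lambda>g. g \<bullet> pgrad Vb i X \<ge> 0 \<and> g \<bullet> pgrad V i X \<ge> 0) g)"

definition controller ::
    "('n \<times> 'n) set \<Rightarrow> (('d::finite, 'n::finite) config \<Rightarrow> real) \<Rightarrow> (('d, 'n) config \<Rightarrow> real) \<Rightarrow>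
     ('n \<Rightarrow> real) \<Rightarrow> ('n \<Rightarrow> real) \<Rightarrow> ('n \<Rightarrow> real) \<Rightarrow> ('n \<Rightarrow> real) \<Rightarrow>
     'n \<Rightarrow> ('d, 'n) config \<Rightarrow> real ^ 'd" where
  "controller E Vb V l \<eta> \<kappa> \<mu> i X =
     (if i \<in> tails E then - gbar Vb V l \<eta> i X - \<kappa> i *\<^sub>R pgrad V i X
      else - (\<mu> i *\<^sub>R pgrad V i X))"

text \<open>The definite descriptions in \<open>pgrad\<close> and \<open>gbar\<close> are well defined.\<close>

lemma gderiv_ex1:
  fixes f :: "'a::euclidean_space \<Rightarrow> real"
  assumes "f differentiable (at x)"
  shows "\<exists>!D. GDERIV f x :> D"
proof -
  obtain f' where f': "(f has_derivative f') (at x)"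
    using assms by (auto simp: differentiable_def)
  have lin: "linear f'"
    using f' has_derivative_linear by blast
  let ?D = "adjoint f' 1"
  have "f' = (\<lambda>h. h \<bullet> ?D)"
    using adjoint_works[OF lin, of _ 1] by auto
  then have "GDERIV f x :> ?D"
    using f' by (simp add: gderiv_def)
  moreover have "D = ?D" if "GDERIV f x :> D" for D
  proof -
    have "(\<lambda>h. h \<bullet> D) = (\<lambda>h. h \<bullet> ?D)"
      using has_derivative_unique that calculation unfolding gderiv_def by blast
    then show ?thesis
      by (metis inner_commute vector_eq_ldot)
  qed
  ultimately show ?thesis by blast
qed

lemma GDERIV_pgrad:
  assumes "V differentiable (at X)"
  shows "GDERIV (\<lambda>y. V (set_column X i y)) (X $ i) :> pgrad V i X"
proof -
  have eq: "set_column X i y = (X - axis i (X $ i)) + axis i y" for y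
    by (auto simp: set_column_def vec_eq_iff axis_def)
  have "bounded_linear (\<lambda>y. axis i y :: (real ^ 'a) ^ 'b)"
    by (rule linear_conv_bounded_linear[THEN iffD1])
       (auto intro!: linearI simp: vec_eq_iff axis_def)
  then have "(\<lambda>y. set_column X i y) differentiable (at (X $ i))"
    unfolding eq by (intro differentiable_add differentiable_const bounded_linear_imp_differentiable)
  moreover have "set_column X i (X $ i) = X"
    by (auto simp: set_column_def vec_eq_iff)
  ultimately have "(\<lambda>y. V (set_column X i y)) differentiable (at (X $ i))"
    using differentiable_chain_at[of "set_column X i" "X $ i" V] assms by (simp add: o_def)
  then show ?thesis
    unfolding pgrad_def by (rule theI'[OF gderiv_ex1])
qed

lemma gbar_ex1:
  fixes a b c :: "'a::euclidean_space"
  shows "\<exists>!g. is_arg_min (\<lambda>g. (norm (g - c))\<^sup>2) (\<lambda>g. g \<bullet> a \<ge> 0 \<and> g \<bullet> b \<ge> 0) g"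
proof -
  let ?S = "{g. g \<bullet> a \<ge> 0} \<inter> {g. g \<bullet> b \<ge> 0}"
  have conv: "convex ?S"
    by (intro convex_Int) (auto simp: convex_def inner_add_left)
  have clos: "closed ?S"
    by (intro closed_Int closed_Collect_le continuous_intros)
  have "0 \<in> ?S" by simp
  then have ne: "?S \<noteq> {}" by blast
  have iff: "is_arg_min (\<lambda>g. (norm (g - c))\<^sup>2) (\<lambda>g. g \<bullet> a \<ge> 0 \<and> g \<bullet> b \<ge> 0) g
      \<longleftrightarrow> g \<in> ?S \<and> (\<forall>z\<in>?S. dist c g \<le> dist c z)" for g
    by (auto simp: is_arg_min_linorder dist_norm norm_minus_commute[of c])
  show ?thesis
    unfolding iff
    using closest_point_exists[OF clos ne, of c] closest_point_unique[OF conv clos] by blast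
qed

end

(* The only edges of the closure missing from E are reversed unidirectional edges, and these
   start at heads.  A tail is not a head, so its two partial gradients, the only data of the
   quadratic program, depend on E-neighbours alone; any other node uses only the gradient of
   V_ud, whose bidirectional neighbours are E-neighbours. *)
theory Submission
  imports Defs
begin

lemma depends_only_on_mono:
  assumes "depends_only_on F S" and "S \<subseteq> T"
  shows "depends_only_on F T"
  using assms unfolding depends_only_on_def by blast

lemma neighbors_bidir_edges_subset: "neighbors (bidir_edges E) i \<subseteq> neighbors E i"
  by (auto simp: neighbors_def bidir_edges_def)

text \<open>An edge leaving \<open>i\<close> that the closure adds to \<open>E\<close> reverses a
  unidirectional edge entering \<open>i\<close>, and the latter would make \<open>i\<close> a
  head.\<close>

lemma neighbors_closure_edges:
  assumes "i \<notin> heads E"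
  shows "neighbors (closure_edges E) i = neighbors E i"
  using assms by (auto simp: neighbors_def closure_edges_def heads_def)

theorem theorem1:
  fixes E :: "('n::finite \<times> 'n) set"
    and V_ud Vbar_ud :: "('d::finite, 'n) config \<Rightarrow> real"
    and l \<eta> \<kappa> \<mu> :: "'n \<Rightarrow> real"
  assumes "tails E \<inter> heads E = {}"
    and "continuously_differentiable V_ud" and "\<And>X. V_ud X \<ge> 0"
    and "continuously_differentiable Vbar_ud" and "\<And>X. Vbar_ud X \<ge> 0"
    and "gradient_distributed (bidir_edges E) V_ud"
    and "gradient_distributed (closure_edges E) Vbar_ud"
    and "\<And>i. i \<in> tails E \<Longrightarrow> l i > 0"
    and "\<And>i. i \<in> tails E \<Longrightarrow> \<eta> i > 0"
    and "\<And>i. i \<in> tails E \<Longrightarrow> \<kappa> i \<ge> 0"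
    and "\<And>i. i \<notin> tails E \<Longrightarrow> \<mu> i > 0"
  shows "distributed_controller E (controller E Vbar_ud V_ud l \<eta> \<kappa> \<mu>)"
proof -
  let ?N = "\<lambda>i. insert i (neighbors E i)"
  have V: "depends_only_on (pgrad V_ud i) (?N i)" for i
    using assms(6) neighbors_bidir_edges_subset[of E i]
    by (meson depends_only_on_mono gradient_distributed_def insert_mono)
  \<comment> \<open>Restricted to tails because at a head the closure adds neighbours outside
    \<open>neighbors E i\<close>.\<close>
  have Vbar: "depends_only_on (pgrad Vbar_ud i) (?N i)" if "i \<in> tails E" for i
  proof -
    have "i \<notin> heads E"
      using assms(1) that by blast
    with assms(7) show ?thesis
      by (metis gradient_distributed_def neighbors_closure_edges)
  qed
  have "controller E Vbar_ud V_ud l \<eta> \<kappa> \<mu> i X = controller E Vbar_ud V_ud l \<eta> \<kappa> \<mu> i Y"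
    if eq: "\<forall>j\<in>?N i. X $ j = Y $ j" for i X Y
  proof -
    have "pgrad V_ud i X = pgrad V_ud i Y"
      using V eq unfolding depends_only_on_def by blast
    moreover have "pgrad Vbar_ud i X = pgrad Vbar_ud i Y" if "i \<in> tails E"
      using Vbar[OF that] eq unfolding depends_only_on_def by blast
    \<comment> \<open>At a tail, equal gradients give \<open>X\<close> and \<open>Y\<close> the same
      objective and constraints, hence the same \<open>gbar\<close>. At any other node the
      controller involves only the gradient of \<open>V_ud\<close>.\<close>
    ultimately show ?thesis
      by (simp add: controller_def gbar_def)
  qed
  then show ?thesis
    unfolding distributed_controller_def depends_only_on_def by blast
qed

end
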